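(* Let $F:\mathbb{R}^{m\times n}\to\mathbb{R}^{m\times n}$ satisfy, for constants $L\ge0$, $\ell\in\mathbb{R}$, $\varepsilon_r\ge0$: (a) $\|F(X)-F(Y)\|_F\le L\|X-Y\|_F$ for all $X,Y\in\mathbb{R}^{m\times n}$; (b) $\langle X-Y,F(X)-F(Y)\rangle\le\ell\|X-Y\|_F^2$ for all $X,Y\in\mathbb{R}^{m\times n}$; (c) $\|\mathcal{P}_Y[F(Y)]-F(Y)\|_F\le\varepsilon_r$ for all $Y\in\mathcal{M}_r$. Let $A(t)$, $t\in[0,T]$, solve $\dot A(t)=F(A(t))$, $A(0)=A_0\in\mathbb{R}^{m\times n}$. Consider an explicit Runge–Kutta method with $s\geq 2$ stages, coefficients $a_{j\ell},b_j$, order $p$ and stage orders $q_1\le q_2\le\dots\le q_s$, and let $Y_0\in\mathcal{M}_r$ and $Y_1,Y_2,\dots$ be the iterates of the corresponding PRK-DEIM method with step size $h$ started at $Y_0$. Set $\delta:=\|A_0-Y_0\|_F$ and $$q=\begin{cases}\min\{p,\,q_2+1\}&\text{if }b_2\ne0,\\ \min\{p,\,q_3+1,\,q_2+2\}&\text{if }b_2=0\end{cases}$$ (with $s\ge3$ in the second case). Then there is $h_0>0$ and there are constants $c_{1,2},c_{3,4}$, not depending on $h$ or $\varepsilon_r$, such that $$\|A(Nh)-Y_N\|_F\le c_{1,2}\big(\delta+c_{3,4}\,C_{m,r}C_{n,r}\,\varepsilon_r+h^q\big)$$ for every $0<h<h_0$ and every $N\in\mathbb{N}$ with $Nh\le 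T$.
   Context: $\mathcal{M}_r=\{X\in\mathbb{R}^{m\times n}\mid\mathrm{rank}(X)=r\}$; $\langle\cdot,\cdot\rangle$ and $\|\cdot\|_F$ are the Frobenius inner product and norm. For $Y=U\Sigma V^\top\in\mathcal{M}_r$ with $U\in\mathbb{R}^{m\times r}$, $V\in\mathbb{R}^{n\times r}$ having orthonormal columns, $\mathcal{P}_Y[Z]=UU^\top Z+ZVV^\top-UU^\top ZVV^\top$ is the orthogonal projection onto the tangent space $T_Y\mathcal{M}_r$. $\mathcal{T}_r(X)$ denotes rank-$r$ truncation, i.e. a best rank-$r$ approximation of $X$ in the Frobenius norm; it is tacitly assumed that all truncations that occur lie in $\mathcal{M}_r$. A selection matrix is a matrix whose columns are distinct standard unit vectors. A DEIM procedure is a rule assigning to each $U\in\mathbb{R}^{m\times r}$ with orthonormal columns a selection matrix $S_U\in\mathbb{R}^{m\times r}$ with $S_U^\top U$ invertible and $\|(S_U^\top U)^{-1}\|_2\le C_{m,r}$, and to each $V\in\mathbb{R}^{n\times r}$ with orthonormal columns a selection matrix $S_V\in\mathbb{R}^{n\times r}$ with $S_V^\top V$ invertible and $\|(S_V^\top V)^{-1}\|_2\le C_{n,r}$, where $C_{m,r},C_{n,r}$ are constants. For $Y=U\Sigma V^\top\in\mathcal{M}_r$, $$\mathcal{P}^{\angle}_Y[Z]=P_U^{\angle}Z-P_U^{\angle}ZP_V^{\vee}+ZP_V^{\vee},\qquad P_U^{\angle}=U(S_U^\top U)^{-1}S_U^\top,\quad P_V^{\vee}=S_V(V^\top S_V)^{-1}V^\top.$$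 Explicit Runge–Kutta method with $s$ stages (step size $h$, starting from $A_i$): $\tilde Z_j=A_i+h\sum_{\ell=1}^{j-1}a_{j\ell}F(\tilde Z_\ell)$ for $j=1,\dots,s$, and $A_{i+1}=A_i+h\sum_{j=1}^sb_jF(\tilde Z_j)$. Corresponding PRK-DEIM method: $Z_j=Y_i+h\sum_{\ell=1}^{j-1}a_{j\ell}\,\mathcal{P}^{\angle}_{\mathcal{T}_r(Z_\ell)}[F(\mathcal{T}_r(Z_\ell))]$ for $j=1,\dots,s$, and $Y_{i+1}=\mathcal{T}_r\big(Y_i+h\sum_{j=1}^sb_j\,\mathcal{P}^{\angle}_{\mathcal{T}_r(Z_j)}[F(\mathcal{T}_r(Z_j))]\big)$. Orders: let $\phi_F^t$ be the flow of $\dot A=F(A)$ and $c_j=\sum_\ell a_{j\ell}$. $F$ is taken sufficiently smooth for the method to have its orders, meaning: there are constants $C_L,h_*>0$ (independent of $h$, $\varepsilon_r$ and of the starting value $Y\in\mathcal{M}_r$) such that for $0<h\le h_*$ the Runge–Kutta step from $A_i=Y$ satisfies $\|A_{i+1}-\phi_F^h(Y)\|_F\le C_Lh^{p+1}$ (order $p$) and $\|\tilde Z_j-\phi_F^{c_jh}(Y)\|_F\le C_Lh^{q_j+1}$ (stage $j$ has order $q_j$). *)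

theory Defs
  imports "HOL-Analysis.Analysis"
begin

text \<open>
  An $m \times n$ matrix is an element of \<^typ>\<open>real^'n^'m\<close>. On this type the library's \<^const>\<open>norm\<close> and
  \<^const>\<open>inner\<close> are the Frobenius norm and inner product, whereas the spectral norm of \<open>M\<close> is
  \<open>onorm ((*v) M)\<close>. The rank parameter $r \geq 1$ is the cardinality of the index type \<open>'r\<close>.
\<close>

definition orthonormal_columns :: "real^'r^'m \<Rightarrow> bool" where
  "orthonormal_columns U \<longleftrightarrow>
     (\<forall>i j. inner (column i U) (column j U) = (if i = j then 1 else 0))"

text \<open>\<open>S\<close> is the (not necessarily diagonal) middle factor.\<close>

definition factorization :: "real^'n^'m \<Rightarrow> real^'r^'m \<Rightarrow> real^'r^'r \<Rightarrow> real^'r^'n \<Rightarrow> bool" where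
  "factorization Y U S V \<longleftrightarrow>
     orthonormal_columns U \<and> orthonormal_columns V \<and> Y = U ** S ** transpose V"

text \<open>
  For \<open>Y\<close> of rank $r$ with factors \<open>U\<close>, \<open>V\<close> this is the orthogonal projection onto the tangent space
  at \<open>Y\<close> of the manifold of rank-$r$ matrices; it does not depend on the chosen factorization of \<open>Y\<close>.
\<close>

definition tangent_proj :: "real^'r^'m \<Rightarrow> real^'r^'n \<Rightarrow> real^'n^'m \<Rightarrow> real^'n^'m" where
  "tangent_proj U V Z =
     U ** transpose U ** Z + Z ** V ** transpose V - U ** transpose U ** Z ** V ** transpose V"

definition best_approx :: "nat \<Rightarrow> real^'n^'m \<Rightarrow> real^'n^'m \<Rightarrow> bool" where
  "best_approx r X W \<longleftrightarrow>
     rank W \<le> r \<and> (\<forall>W'. rank W' \<le> r \<longrightarrow> norm (X - W) \<le> norm (X - W'))"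

definition selection_matrix :: "real^'r^'m \<Rightarrow> bool" where
  "selection_matrix S \<longleftrightarrow> (\<exists>f. inj f \<and> (\<forall>k. column k S = axis (f k) 1))"

definition deim_rule :: "real \<Rightarrow> (real^'r^'m \<Rightarrow> real^'r^'m) \<Rightarrow> bool" where
  "deim_rule C S \<longleftrightarrow>
     (\<forall>U. orthonormal_columns U \<longrightarrow>
        selection_matrix (S U) \<and>
        invertible (transpose (S U) ** U) \<and>
        onorm ((*v) (matrix_inv (transpose (S U) ** U))) \<le> C)"

definition deim_left :: "real^'r^'m \<Rightarrow> real^'r^'m \<Rightarrow> real^'m^'m" where
  "deim_left S U = U ** matrix_inv (transpose S ** U) ** transpose S"

definition deim_right :: "real^'r^'n \<Rightarrow> real^'r^'n \<Rightarrow> real^'n^'n" where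
  "deim_right S V = S ** matrix_inv (transpose V ** S) ** transpose V"

text \<open>
  The oblique projection depends on the factors of \<open>Y\<close> through the selection matrices, so the factors
  are supplied by maps \<open>Uf\<close>, \<open>Vf\<close> choosing a factorization of every rank-$r$ matrix.
\<close>

definition factor_rule :: "(real^'n^'m \<Rightarrow> real^'r^'m) \<Rightarrow> (real^'n^'m \<Rightarrow> real^'r^'n) \<Rightarrow> bool" where
  "factor_rule Uf Vf \<longleftrightarrow>
     (\<forall>Y. rank Y = CARD('r) \<longrightarrow> (\<exists>S. factorization Y (Uf Y) S (Vf Y)))"

definition deim_proj ::
  "(real^'n^'m \<Rightarrow> real^'r^'m) \<Rightarrow> (real^'n^'m \<Rightarrow> real^'r^'n) \<Rightarrow>
   (real^'r^'m \<Rightarrow> real^'r^'m) \<Rightarrow> (real^'r^'n \<Rightarrow> real^'r^'n) \<Rightarrow>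
   real^'n^'m \<Rightarrow> real^'n^'m \<Rightarrow> real^'n^'m" where
  "deim_proj Uf Vf SU SV Y Z =
     (let PU = deim_left (SU (Uf Y)) (Uf Y); PV = deim_right (SV (Vf Y)) (Vf Y)
      in PU ** Z - PU ** Z ** PV + Z ** PV)"

definition is_flow :: "('a::real_normed_vector \<Rightarrow> 'a) \<Rightarrow> (real \<Rightarrow> 'a \<Rightarrow> 'a) \<Rightarrow> bool" where
  "is_flow F \<phi> \<longleftrightarrow>
     (\<forall>Y. \<phi> 0 Y = Y \<and> (\<forall>t. ((\<lambda>\<tau>. \<phi> \<tau> Y) has_vector_derivative F (\<phi> t Y)) (at t)))"

text \<open>Stages are numbered from 1; only the entries \<open>a j l\<close> with \<open>1 \<le> l < j\<close> are ever used.\<close>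

function rk_stage ::
  "(nat \<Rightarrow> nat \<Rightarrow> real) \<Rightarrow> ('a::real_vector \<Rightarrow> 'a) \<Rightarrow> real \<Rightarrow> 'a \<Rightarrow> nat \<Rightarrow> 'a" where
  "rk_stage a F h A j = A + h *\<^sub>R (\<Sum>l = 1..<j. a j l *\<^sub>R F (rk_stage a F h A l))"
  by pat_completeness auto
termination
  by (relation "Wellfounded.measure (\<lambda>(a, F, h, A, j). j)") auto

declare rk_stage.simps [simp del]

definition rk_step ::
  "nat \<Rightarrow> (nat \<Rightarrow> nat \<Rightarrow> real) \<Rightarrow> (nat \<Rightarrow> real) \<Rightarrow> ('a::real_vector \<Rightarrow> 'a) \<Rightarrow> real \<Rightarrow> 'a \<Rightarrow> 'a" where
  "rk_step s a b F h A = A + h *\<^sub>R (\<Sum>j = 1..s. b j *\<^sub>R F (rk_stage a F h A j))"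

definition rk_node :: "(nat \<Rightarrow> nat \<Rightarrow> real) \<Rightarrow> nat \<Rightarrow> real" where
  "rk_node a j = (\<Sum>l = 1..<j. a j l)"

text \<open>
  \<open>Tr\<close> is the truncation and \<open>P Y Z\<close> the projection of \<open>Z\<close> at \<open>Y\<close>. The recursion for the stages
  is the Runge--Kutta recursion with \<open>F Z\<close> replaced by \<open>P (Tr Z) (F (Tr Z))\<close>.
\<close>

definition prk_stage ::
  "(nat \<Rightarrow> nat \<Rightarrow> real) \<Rightarrow> ('a::real_vector \<Rightarrow> 'a) \<Rightarrow> ('a \<Rightarrow> 'a \<Rightarrow> 'a) \<Rightarrow> ('a \<Rightarrow> 'a) \<Rightarrow>
   real \<Rightarrow> 'a \<Rightarrow> nat \<Rightarrow> 'a" where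
  "prk_stage a Tr P F h Y j = rk_stage a (\<lambda>Z. P (Tr Z) (F (Tr Z))) h Y j"

definition prk_step ::
  "nat \<Rightarrow> (nat \<Rightarrow> nat \<Rightarrow> real) \<Rightarrow> (nat \<Rightarrow> real) \<Rightarrow> ('a::real_vector \<Rightarrow> 'a) \<Rightarrow> ('a \<Rightarrow> 'a \<Rightarrow> 'a) \<Rightarrow>
   ('a \<Rightarrow> 'a) \<Rightarrow> real \<Rightarrow> 'a \<Rightarrow> 'a" where
  "prk_step s a b Tr P F h Y = Tr (rk_step s a b (\<lambda>Z. P (Tr Z) (F (Tr Z))) h Y)"

definition prk_iterate ::
  "nat \<Rightarrow> (nat \<Rightarrow> nat \<Rightarrow> real) \<Rightarrow> (nat \<Rightarrow> real) \<Rightarrow> ('a::real_vector \<Rightarrow> 'a) \<Rightarrow> ('a \<Rightarrow> 'a \<Rightarrow> 'a) \<Rightarrow>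
   ('a \<Rightarrow> 'a) \<Rightarrow> real \<Rightarrow> 'a \<Rightarrow> nat \<Rightarrow> 'a" where
  "prk_iterate s a b Tr P F h Y0 i = (prk_step s a b Tr P F h ^^ i) Y0"

lemma prk_stage_eq:
  "prk_stage a Tr P F h Y j =
     Y + h *\<^sub>R (\<Sum>l = 1..<j. a j l *\<^sub>R
       P (Tr (prk_stage a Tr P F h Y l)) (F (Tr (prk_stage a Tr P F h Y l))))"
  unfolding prk_stage_def by (subst rk_stage.simps) simp

lemma prk_step_eq:
  "prk_step s a b Tr P F h Y =
     Tr (Y + h *\<^sub>R (\<Sum>j = 1..s. b j *\<^sub>R
       P (Tr (prk_stage a Tr P F h Y j)) (F (Tr (prk_stage a Tr P F h Y j)))))"
  by (simp add: prk_step_def rk_step_def prk_stage_def)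

definition order_bounds ::
  "nat \<Rightarrow> nat \<Rightarrow> (nat \<Rightarrow> nat \<Rightarrow> real) \<Rightarrow> (nat \<Rightarrow> real) \<Rightarrow> nat \<Rightarrow> (nat \<Rightarrow> nat) \<Rightarrow> real \<Rightarrow> real \<Rightarrow>
   (real^'n^'m \<Rightarrow> real^'n^'m) \<Rightarrow> (real \<Rightarrow> real^'n^'m \<Rightarrow> real^'n^'m) \<Rightarrow> bool" where
  "order_bounds r s a b p q C hs F \<phi> \<longleftrightarrow>
     (\<forall>Y h. rank Y = r \<and> 0 < h \<and> h \<le> hs \<longrightarrow>
        norm (rk_step s a b F h Y - \<phi> h Y) \<le> C * h ^ (p + 1) \<and>
        (\<forall>j\<in>{1..s}.
           norm (rk_stage a F h Y j - \<phi> (rk_node a j * h) Y) \<le> C * h ^ (q j + 1)))"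

end

theory Submission
  imports Defs
begin

text \<open>
  The DEIM projection of \<open>F Y\<close> differs from \<open>F Y\<close> by at most $\eta = 4 C_{m,r} C_{n,r} \varepsilon_r$. The core is
  that the exact flow started in $\mathcal{M}_r$ stays within $O(t \varepsilon_r)$ of the matrices of rank at
  most $r$, with a constant that does not involve the singular values: at a best approximation $W$ of $X$ the
  residual $X - W$ is orthogonal to the tangent space, so
  $\langle X - W, F(X) \rangle \le L \|X - W\|^2 + \varepsilon_r \|X - W\|$, and this inner product bounds the growth of
  half the squared distance because $W$ may be kept fixed as a competitor. Hence a truncation costs no more than
  the distance to the exact flow plus $O(h \varepsilon_r)$, and the truncated stages differ from the Runge--Kutta
  stages by $O(h \eta + h^{q_2 + 1})$, and from the third stage on by $O(h \eta + h^{q_2 + 2} + h^{q_3 + 1})$, since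
  the first stage is exact. This gives a local error of $O(h (\eta + h^q))$, which the stability of the flow
  propagates.
\<close>

subsection \<open>Oblique and orthogonal projections\<close>

text \<open>Minimising the quadratic \<open>t\<close> to squared norm of
  \<open>R - t *\<^sub>R D\<close> would otherwise go below the value at 0. With \<open>D\<close> a
  direction that keeps the rank bound, this is the first-order optimality condition of a best
  approximation.\<close>

lemma inner_eq_0_if_norm_minimal:
  fixes R D :: "'a::real_inner"
  assumes "\<And>t. norm R \<le> norm (R - t *\<^sub>R D)"
  shows "inner R D = 0"
proof (cases "D = 0")
  case False
  define t where "t = inner R D / (norm D)\<^sup>2"
  have "(norm R)\<^sup>2 \<le> (norm (R - t *\<^sub>R D))\<^sup>2"
    using assms by (simp add: power_mono)
  also have "\<dots> = (norm R)\<^sup>2 - 2 * t * inner R D + t\<^sup>2 * (norm D)\<^sup>2"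
    unfolding power2_norm_eq_inner
    by (simp add: inner_diff_left inner_diff_right inner_commute power2_eq_square)
  also have "\<dots> = (norm R)\<^sup>2 - (inner R D)\<^sup>2 / (norm D)\<^sup>2"
    using False by (simp add: t_def field_simps power2_eq_square)
  finally show ?thesis
    using False by (simp add: divide_le_0_iff)
qed simp

section \<open>Matrix algebra and the Frobenius norm\<close>

lemma transpose_diff: "transpose ((A :: real^'n^'m) - B) = transpose A - transpose B"
  by (simp add: vec_eq_iff transpose_def)

lemma matrix_sub_ldistrib: "(A :: real^'n^'m) ** (B - C) = A ** B - A ** C"
  by (simp add: vec_eq_iff matrix_matrix_mult_def right_diff_distrib sum_subtractf)

lemma matrix_sub_rdistrib: "((B :: real^'n^'m) - C) ** A = B ** A - C ** A"
  by (simp add: vec_eq_iff matrix_matrix_mult_def left_diff_distrib sum_subtractf)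

lemma matrix_add_rdistrib: "((A :: real^'n^'m) + B) ** C = A ** C + B ** C"
  by (simp add: vec_eq_iff matrix_matrix_mult_def distrib_right sum.distrib)

lemma matrix_mult_scaleR: "(A :: real^'n^'m) ** (t *\<^sub>R B) = t *\<^sub>R (A ** B)"
  by (simp add: vec_eq_iff matrix_matrix_mult_def sum_distrib_left mult_ac)

lemma scaleR_matrix_mult: "(t *\<^sub>R (A :: real^'n^'m)) ** B = t *\<^sub>R (A ** B)"
  by (simp add: vec_eq_iff matrix_matrix_mult_def sum_distrib_left mult_ac)

lemma matrix_mult_minus: "(A :: real^'n^'m) ** (- B) = - (A ** B)"
  by (simp add: vec_eq_iff matrix_matrix_mult_def sum_negf)

lemma minus_matrix_mult: "(- (A :: real^'n^'m)) ** B = - (A ** B)"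
  by (simp add: vec_eq_iff matrix_matrix_mult_def sum_negf)

lemma norm_matrix_columns:
  fixes A :: "real^'n^'m"
  shows "(norm A)\<^sup>2 = (\<Sum>j\<in>UNIV. (norm (column j A))\<^sup>2)"
proof -
  have "(norm A)\<^sup>2 = (\<Sum>i\<in>UNIV. \<Sum>j\<in>UNIV. A $ i $ j * A $ i $ j)"
    by (simp add: power2_norm_eq_inner inner_vec_def)
  also have "\<dots> = (\<Sum>j\<in>UNIV. \<Sum>i\<in>UNIV. A $ i $ j * A $ i $ j)"
    by (rule sum.swap)
  finally show ?thesis
    by (simp add: power2_norm_eq_inner inner_vec_def column_def)
qed

lemma norm_transpose_matrix:
  fixes A :: "real^'n^'m"
  shows "norm (transpose A) = norm A"
proof -
  have "(norm (transpose A))\<^sup>2 = (norm A)\<^sup>2"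
    by (subst norm_matrix_columns)
      (simp add: power2_norm_eq_inner inner_vec_def column_def transpose_def)
  then show ?thesis by simp
qed

lemma column_matrix_mult: "column j (A ** B) = A *v column j B"
  by (simp add: vec_eq_iff column_def matrix_matrix_mult_def matrix_vector_mult_def)

text \<open>The squared Frobenius norm is the sum of the squared column norms, and \<open>A\<close>
  acts on each column of \<open>B\<close> separately.\<close>

lemma norm_matrix_mult_le:
  fixes A :: "real^'n^'m" and B :: "real^'k^'n"
  assumes "\<And>x. norm (A *v x) \<le> c * norm x" "c \<ge> 0"
  shows "norm (A ** B) \<le> c * norm B"
proof -
  have "(norm (A ** B))\<^sup>2 \<le> (\<Sum>j\<in>UNIV. (c * norm (column j B))\<^sup>2)"
    unfolding norm_matrix_columns column_matrix_mult
    by (intro sum_mono power_mono assms) simp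
  also have "\<dots> = (c * norm B)\<^sup>2"
    by (simp add: power_mult_distrib norm_matrix_columns sum_distrib_left)
  finally show ?thesis
    using assms(2) by (simp add: abs_le_square_iff[symmetric] abs_mult)
qed

section \<open>Orthonormal columns, selection matrices and inverses\<close>

lemma orthonormal_columns_iff: "orthonormal_columns U \<longleftrightarrow> transpose U ** U = mat 1"
  by (auto simp: orthonormal_columns_def vec_eq_iff matrix_matrix_mult_def transpose_def mat_def
      inner_vec_def column_def)

lemma norm_orthonormal_mult:
  assumes "orthonormal_columns U"
  shows "norm (U *v x) = norm x"
proof -
  have "inner (U *v x) (U *v x) = inner (transpose U *v (U *v x)) x"
    by (metis dot_lmul_matrix transpose_matrix_vector)
  also have "\<dots> = inner x x"
    using assms by (simp add: orthonormal_columns_iff matrix_vector_mul_assoc)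
  finally show ?thesis by (simp add: norm_eq_sqrt_inner)
qed

text \<open>For \<open>y = transpose U *v x\<close> the squared norm is the inner product of
  \<open>x\<close> and \<open>U *v y\<close>; apply Cauchy-Schwarz and the isometry
  \<open>U\<close>, then cancel a factor.\<close>

lemma norm_orthonormal_transpose_mult:
  assumes "orthonormal_columns U"
  shows "norm (transpose U *v x) \<le> norm x"
proof -
  let ?y = "transpose U *v x"
  have "(norm ?y)\<^sup>2 = inner x (U *v ?y)"
    by (metis dot_lmul_matrix power2_norm_eq_inner transpose_matrix_vector)
  also have "\<dots> \<le> norm x * norm (U *v ?y)"
    by (rule norm_cauchy_schwarz)
  also have "\<dots> = norm x * norm ?y"
    using assms by (simp add: norm_orthonormal_mult)
  finally have "norm ?y * norm ?y \<le> norm x * norm ?y"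
    by (simp add: power2_eq_square)
  then show ?thesis
    by (cases "?y = 0") simp_all
qed

lemma orthonormal_selection:
  assumes "selection_matrix S"
  shows "orthonormal_columns S"
proof -
  obtain f where "inj f" "\<And>k. column k S = axis (f k) 1"
    using assms by (auto simp: selection_matrix_def)
  then show ?thesis
    by (auto simp: orthonormal_columns_def inner_axis_axis inj_eq)
qed

lemma matrix_inv_left:
  fixes A :: "real^'n^'n"
  assumes "invertible A"
  shows "matrix_inv A ** A = mat 1"
  using someI_ex[OF assms[unfolded invertible_def]] by (simp add: matrix_inv_def)

lemma matrix_inv_unique:
  fixes A :: "real^'n^'n"
  assumes "A ** B = mat 1"
  shows "matrix_inv A = B"
proof -
  have "B ** A = mat 1"
    using assms by (simp add: matrix_left_right_inverse)
  then have "invertible A" using assms by (auto simp: invertible_def)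
  then have "matrix_inv A ** A = mat 1" by (rule matrix_inv_left)
  then show ?thesis
    by (metis assms matrix_mul_assoc matrix_mul_lid matrix_mul_rid)
qed

text \<open>Reduces the right projector to a left one, so that only left projectors have to be
  estimated.\<close>

lemma deim_right_eq:
  fixes S V :: "real^'r^'n"
  assumes "invertible (transpose S ** V)"
  shows "deim_right S V = transpose (deim_left S V)"
proof -
  have "matrix_inv (transpose V ** S) = transpose (matrix_inv (transpose S ** V))"
  proof (rule matrix_inv_unique)
    have "transpose V ** S = transpose (transpose S ** V)"
      by (simp add: matrix_transpose_mul)
    then have "transpose V ** S ** transpose (matrix_inv (transpose S ** V)) =
        transpose (matrix_inv (transpose S ** V) ** (transpose S ** V))"
      by (simp add: matrix_transpose_mul)
    also have "\<dots> = mat 1"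
      using assms by (simp add: matrix_inv_left transpose_mat)
    finally show "transpose V ** S ** transpose (matrix_inv (transpose S ** V)) = mat 1" .
  qed
  then show ?thesis
    by (simp add: deim_right_def deim_left_def matrix_transpose_mul matrix_mul_assoc)
qed

section \<open>Bounds for the oblique DEIM projectors\<close>

context
  fixes C :: real and SU :: "real^'r^'m \<Rightarrow> real^'r^'m" and U :: "real^'r^'m"
  assumes rule: "deim_rule C SU" and U: "orthonormal_columns U"
begin

lemma deim_invertible: "invertible (transpose (SU U) ** U)"
  using rule U by (simp add: deim_rule_def)

lemma deim_inv_bound: "norm (matrix_inv (transpose (SU U) ** U) *v x) \<le> C * norm x"
proof -
  let ?N = "matrix_inv (transpose (SU U) ** U)"
  have "norm (?N *v x) \<le> onorm ((*v) ?N) * norm x"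
    by (rule onorm) (rule matrix_vector_mul_bounded_linear)
  also have "\<dots> \<le> C * norm x"
    using rule U by (intro mult_right_mono) (auto simp: deim_rule_def)
  finally show ?thesis .
qed

lemma deim_orthonormal: "orthonormal_columns (SU U)"
  using rule U by (simp add: deim_rule_def orthonormal_selection)

text \<open>Both \<open>SU U\<close> and \<open>U\<close> have orthonormal columns, so
  \<open>transpose (SU U) ** U\<close> is a contraction and its inverse has norm at least 1.\<close>

lemma deim_const_ge_1: "C \<ge> 1"
proof -
  obtain x :: "real^'r" where x: "norm x = 1"
    using vector_choose_size[of 1] by auto
  have n: "norm ((transpose (SU U) ** U) *v x) \<le> 1"
    using norm_orthonormal_transpose_mult[OF deim_orthonormal, of "U *v x"] x
    by (simp add: norm_orthonormal_mult[OF U] matrix_vector_mul_assoc)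
  have "1 = norm (matrix_inv (transpose (SU U) ** U) *v ((transpose (SU U) ** U) *v x))"
    using x by (simp add: matrix_vector_mul_assoc matrix_inv_left[OF deim_invertible])
  also have "\<dots> \<le> C * norm ((transpose (SU U) ** U) *v x)"
    by (rule deim_inv_bound)
  finally have le: "1 \<le> C * norm ((transpose (SU U) ** U) *v x)" .
  then have "C > 0"
    by (smt (verit) norm_ge_zero mult_nonpos_nonneg)
  with le n show ?thesis
    by (smt (verit) mult_left_le)
qed

text \<open>\<open>U\<close> preserves norms and \<open>transpose (SU U)\<close> does not increase
  them; only the inverse contributes a factor.\<close>

lemma deim_left_bound: "norm (deim_left (SU U) U *v x) \<le> C * norm x"
proof -
  have "norm (deim_left (SU U) U *v x) =
      norm (matrix_inv (transpose (SU U) ** U) *v (transpose (SU U) *v x))"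
    by (simp add: deim_left_def norm_orthonormal_mult[OF U] matrix_vector_mul_assoc[symmetric])
  also have "\<dots> \<le> C * norm (transpose (SU U) *v x)"
    by (rule deim_inv_bound)
  also have "\<dots> \<le> C * norm x"
    using deim_const_ge_1
    by (intro mult_left_mono norm_orthonormal_transpose_mult deim_orthonormal) simp
  finally show ?thesis .
qed

lemma deim_left_fixes: "deim_left (SU U) U ** U = U"
  by (simp add: deim_left_def matrix_mul_assoc[symmetric] matrix_inv_left[OF deim_invertible])

text \<open>Uses \<open>1 + C \<le> 2 * C\<close>. Applied once on each side, it produces the factor
  4 in the DEIM defect.\<close>

lemma deim_left_complement_bound:
  fixes E :: "real^'k^'m"
  shows "norm (E - deim_left (SU U) U ** E) \<le> 2 * C * norm E"
proof -
  have "norm (deim_left (SU U) U ** E) \<le> C * norm E"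
    using deim_const_ge_1 by (intro norm_matrix_mult_le deim_left_bound) simp
  moreover have "norm E \<le> C * norm E"
    using mult_right_mono[OF deim_const_ge_1 norm_ge_zero, of E] by simp
  ultimately show ?thesis
    using norm_triangle_ineq4[of E "deim_left (SU U) U ** E"] by simp
qed

end

text \<open>
  Since the oblique projectors fix the ranges of \<open>U\<close> and \<open>V\<close>, the error of the DEIM projection is the
  error of the orthogonal one multiplied by the complementary oblique projectors.
\<close>

lemma deim_proj_error:
  fixes SU :: "real^'r^'m \<Rightarrow> real^'r^'m" and SV :: "real^'r^'n \<Rightarrow> real^'r^'n" and Z :: "real^'n^'m"
  assumes "deim_rule Cm SU" "deim_rule Cn SV"
    and U: "orthonormal_columns (Uf Y)" and V: "orthonormal_columns (Vf Y)"
  shows "norm (deim_proj Uf Vf SU SV Y Z - Z)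
    \<le> 4 * Cm * Cn * norm (tangent_proj (Uf Y) (Vf Y) Z - Z)"
proof -
  define U V where "U = Uf Y" and "V = Vf Y"
  note oU = U[folded U_def] and oV = V[folded V_def]
  define P Q where "P = deim_left (SU U) U" and "Q = deim_left (SV V) V"
  define E where "E = Z - tangent_proj U V Z"
  define G where "G = E - P ** E"
  have PU: "P ** U = U" and QV: "Q ** V = V"
    unfolding P_def Q_def using deim_left_fixes assms(1,2) oU oV by blast+
  have VQ: "transpose V ** transpose Q = transpose V"
    using QV by (metis matrix_transpose_mul)
  have E: "E = Z - (U ** transpose U ** Z) - (Z ** V ** transpose V - U ** transpose U ** Z ** V ** transpose V)"
    by (simp add: E_def tangent_proj_def)
  \<comment> \<open>As \<open>P\<close> fixes \<open>U\<close>, the terms of \<open>E\<close> that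
    begin with \<open>U\<close> cancel in \<open>G\<close>.\<close>
  have PE: "G = (Z - P ** Z) - (Z - P ** Z) ** V ** transpose V"
    by (simp add: G_def E matrix_sub_ldistrib matrix_sub_rdistrib matrix_mul_assoc PU)
  \<comment> \<open>By \<open>VQ\<close> the terms ending in \<open>transpose V\<close> cancel, so
    the two complementary projectors act on \<open>E\<close> exactly as they do on
    \<open>Z\<close>.\<close>
  have GQ: "G - G ** transpose Q = (Z - P ** Z) - (Z - P ** Z) ** transpose Q"
    by (simp add: PE matrix_sub_rdistrib matrix_mul_assoc[symmetric] VQ)
  have "deim_proj Uf Vf SU SV Y Z = P ** Z - P ** Z ** transpose Q + Z ** transpose Q"
    using deim_right_eq[OF deim_invertible[OF assms(2) oV]]
    by (simp add: deim_proj_def Let_def P_def Q_def U_def V_def)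
  then have "deim_proj Uf Vf SU SV Y Z - Z = - (G - G ** transpose Q)"
    unfolding GQ by (simp add: matrix_sub_rdistrib)
  then have "norm (deim_proj Uf Vf SU SV Y Z - Z) = norm (G - G ** transpose Q)"
    by (simp only: norm_minus_cancel)
  \<comment> \<open>Transposition moves the right factor to the left, where the complement bound
    applies.\<close>
  also have "\<dots> = norm (transpose G - Q ** transpose G)"
    by (subst norm_transpose_matrix[symmetric]) (simp add: transpose_diff matrix_transpose_mul)
  also have "\<dots> \<le> 2 * Cn * norm (transpose G)"
    unfolding Q_def using deim_left_complement_bound assms(2) oV by blast
  also have "\<dots> \<le> 2 * Cn * (2 * Cm * norm E)"
    unfolding norm_transpose_matrix G_def P_def
    using deim_left_complement_bound[OF assms(1) oU] deim_const_ge_1[OF assms(2) oV]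
    by (intro mult_left_mono) auto
  finally show ?thesis
    by (simp add: E_def U_def V_def norm_minus_commute mult_ac)
qed

subsection \<open>Distance of the flow to the low-rank matrices\<close>

text \<open>Only column \<open>j\<close> changes, so the column space gains at most one
  dimension.\<close>

lemma rank_add_axis_le:
  fixes W :: "real^'n^'m"
  shows "rank (W + t *\<^sub>R axis i (axis j 1)) \<le> Suc (rank W)"
proof -
  let ?W = "W + t *\<^sub>R axis i (axis j 1)"
  have "column k ?W = column k W" if "k \<noteq> j" for k
    using that by (auto simp: column_def vec_eq_iff axis_def)
  then have "columns ?W \<subseteq> insert (column j ?W) (columns W)"
    by (fastforce simp: columns_def)
  then have "dim (columns ?W) \<le> dim (insert (column j ?W) (columns W))"
    by (rule dim_subset)
  also have "\<dots> \<le> Suc (dim (columns W))"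
    by (simp add: dim_insert)
  finally show ?thesis by (simp add: column_rank_def)
qed

text \<open>Below rank \<open>r\<close> each single entry of \<open>W\<close> could be varied
  freely, and optimality would force the residual to vanish in every entry.\<close>

lemma best_approx_full_rank:
  assumes "best_approx r X W" "W \<noteq> X"
  shows "rank W = r"
proof (rule ccontr)
  assume "rank W \<noteq> r"
  then have less: "Suc (rank W) \<le> r" using assms(1) by (simp add: best_approx_def)
  obtain i j where ij: "X $ i $ j \<noteq> W $ i $ j"
    using assms(2) unfolding vec_eq_iff by metis
  have "inner (X - W) (axis i (axis j 1)) = 0"
  proof (rule inner_eq_0_if_norm_minimal)
    fix t
    have "norm (X - W) \<le> norm (X - (W + t *\<^sub>R axis i (axis j 1)))"
      using assms(1) less rank_add_axis_le[of W t i j] by (auto simp: best_approx_def)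
    then show "norm (X - W) \<le> norm (X - W - t *\<^sub>R axis i (axis j 1))"
      by (simp add: algebra_simps)
  qed
  then show False using ij by (simp add: inner_axis)
qed

lemma best_approx_fixes:
  assumes "best_approx r X W" "rank X \<le> r"
  shows "W = X"
  using assms by (force simp: best_approx_def)

text \<open>
  The linear spaces \<open>U ** M\<close> and \<open>M ** transpose V\<close> consist of matrices of rank at most $r$, so a best
  approximation is optimal within each of them.
\<close>

lemma best_approx_residual_orthogonal:
  fixes X W :: "real^'n^'m" and U :: "real^'r^'m"
  assumes W: "best_approx CARD('r) X W" and fac: "factorization W U S V"
  shows "inner (X - W) (tangent_proj U V Z) = 0"
proof -
  have WU: "W = U ** (S ** transpose V)" and WV: "W = (U ** S) ** transpose V"
    using fac by (simp_all add: factorization_def matrix_mul_assoc)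
  have rU: "rank U \<le> CARD('r)" using rank_bound[of U] by simp
  have rV: "rank (transpose V) \<le> CARD('r)" using rank_bound[of V] by (simp add: rank_transpose)
  have 1: "inner (X - W) (U ** M) = 0" for M
  proof (rule inner_eq_0_if_norm_minimal)
    fix t
    have "W + t *\<^sub>R (U ** M) = U ** (S ** transpose V + t *\<^sub>R M)"
      by (subst WU) (simp add: matrix_add_ldistrib matrix_mult_scaleR)
    then have "rank (W + t *\<^sub>R (U ** M)) \<le> CARD('r)"
      using rank_mul_le_left[of U "S ** transpose V + t *\<^sub>R M"] rU by simp
    then have "norm (X - W) \<le> norm (X - (W + t *\<^sub>R (U ** M)))"
      using W by (simp add: best_approx_def)
    then show "norm (X - W) \<le> norm (X - W - t *\<^sub>R (U ** M))" by (simp add: algebra_simps)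
  qed
  have 2: "inner (X - W) (M ** transpose V) = 0" for M
  proof (rule inner_eq_0_if_norm_minimal)
    fix t
    have "W + t *\<^sub>R (M ** transpose V) = (U ** S + t *\<^sub>R M) ** transpose V"
      by (subst WV) (simp add: matrix_add_rdistrib scaleR_matrix_mult)
    then have "rank (W + t *\<^sub>R (M ** transpose V)) \<le> CARD('r)"
      using rank_mul_le_right[of "U ** S + t *\<^sub>R M" "transpose V"] rV by simp
    then have "norm (X - W) \<le> norm (X - (W + t *\<^sub>R (M ** transpose V)))"
      using W by (simp add: best_approx_def)
    then show "norm (X - W) \<le> norm (X - W - t *\<^sub>R (M ** transpose V))" by (simp add: algebra_simps)
  qed
  have "tangent_proj U V Z = U ** (transpose U ** Z) + (Z ** V) ** transpose V
      - (U ** transpose U ** Z ** V) ** transpose V"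
    by (simp add: tangent_proj_def matrix_mul_assoc)
  then show ?thesis by (simp add: inner_add_right inner_diff_right 1 2)
qed

text \<open>\<open>W'\<close> is a competitor for \<open>X\<close>. The distance to the low-rank
  matrices is thus 1-Lipschitz, although truncation itself may jump.\<close>

lemma best_approx_dist_Lipschitz:
  assumes "best_approx r X W" "best_approx r X' W'"
  shows "norm (X - W) \<le> norm (X' - W') + norm (X - X')"
proof -
  have "norm (X - W) \<le> norm (X - W')"
    using assms by (simp add: best_approx_def)
  also have "\<dots> \<le> norm (X' - W') + norm (X - X')"
    using norm_triangle_ineq[of "X' - W'" "X - X'"] by simp
  finally show ?thesis .
qed

lemma has_vector_derivative_norm_sq:
  fixes X :: "real \<Rightarrow> 'a::real_inner"
  assumes "(X has_vector_derivative D) (at t within S)"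
  shows "((\<lambda>t. (norm (X t - W))\<^sup>2) has_real_derivative 2 * inner (X t - W) D) (at t within S)"
proof -
  have "((\<lambda>t. X t - W) has_vector_derivative D) (at t within S)"
    using assms by (auto intro: derivative_eq_intros)
  then have "((\<lambda>t. inner (X t - W) (X t - W)) has_derivative
      (\<lambda>h. inner (X t - W) (h *\<^sub>R D) + inner (h *\<^sub>R D) (X t - W))) (at t within S)"
    unfolding has_vector_derivative_def by (intro has_derivative_inner)
  then show ?thesis
    unfolding power2_norm_eq_inner has_field_derivative_def
    by (rule has_derivative_eq_rhs) (simp add: inner_commute[of D] fun_eq_iff)
qed

text \<open>
  At the last time \<open>t0\<close> at which the barrier \<open>u\<close> holds, keeping the best approximation \<open>W\<close> at \<open>t0\<close>
  fixed bounds the distance from above at later times, so no curvature of the manifold enters; the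
  distance being positive at \<open>t0\<close>, \<open>W\<close> has full rank $r$, which the hypothesis on \<open>F\<close> needs.
\<close>

lemma flow_dist_low_rank:
  fixes F :: "real^'n^'m \<Rightarrow> real^'n^'m" and Uf :: "real^'n^'m \<Rightarrow> real^'r^'m"
  assumes Lip: "\<And>X Y. norm (F X - F Y) \<le> L * norm (X - Y)" and L: "L \<ge> 0" and e: "\<epsilon> \<ge> 0"
    and tan: "\<And>Y (U :: real^'r^'m) S V. rank Y = CARD('r) \<Longrightarrow> factorization Y U S V \<Longrightarrow>
         norm (tangent_proj U V (F Y) - F Y) \<le> \<epsilon>"
    and fac: "factor_rule Uf Vf"
    and Tr: "\<And>X. best_approx CARD('r) X (Tr X)"
    and X: "\<And>t. (X has_vector_derivative F (X t)) (at t)"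
    and X0: "rank (X 0) = CARD('r)" and t: "t \<ge> 0"
  shows "norm (X t - Tr (X t)) \<le> \<epsilon> * t * exp ((L + 1) * t)"
proof -
  define d where "d t = norm (X t - Tr (X t))" for t
  have Xc: "continuous_on UNIV X"
    using X by (meson continuous_at_imp_continuous_on has_vector_derivative_continuous)
  have dc: "continuous_on UNIV d"
  proof (rule continuous_on_eq_continuous_within[THEN iffD2], rule ballI)
    fix x :: real
    have bnd: "norm (d y - d x) \<le> norm (X y - X x)" for y
      using best_approx_dist_Lipschitz[OF Tr Tr, of "X y" "X x"]
        best_approx_dist_Lipschitz[OF Tr Tr, of "X x" "X y"]
      by (simp add: d_def norm_minus_commute abs_le_iff)
    have "((\<lambda>y. norm (X y - X x)) \<longlongrightarrow> 0) (at x)"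
      using Xc by (auto intro!: tendsto_norm_zero simp: LIM_zero_iff continuous_on_def)
    then have "((\<lambda>y. d y - d x) \<longlongrightarrow> 0) (at x)"
      by (rule Lim_null_comparison[rotated]) (use bnd in auto)
    then show "isCont d x" by (simp add: isCont_def LIM_zero_iff)
  qed
  \<comment> \<open>The slack \<open>k\<close> makes the barrier positive from time 0 on; it is sent
    to 0 at the end.\<close>
  have bound: "d t \<le> (k + \<epsilon> * t) * exp ((L + 1) * t)" if k: "k > 0" for k
  proof (rule ccontr)
    define u where "u t = (k + \<epsilon> * t) * exp ((L + 1) * t)" for t
    assume "\<not> ?thesis"
    then have dt: "d t > u t" by (simp add: u_def)
    have uc: "continuous_on UNIV u" unfolding u_def by (intro continuous_intros)
    define B where "B = {0..t} \<inter> {x. d x \<le> u x}"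
    have "closed {x. d x \<le> u x}" by (rule closed_Collect_le[OF dc uc])
    then have Bc: "compact B" unfolding B_def by (intro compact_Int_closed) auto
    have "d 0 = 0"
      using best_approx_fixes[OF Tr, of "X 0"] X0 by (simp add: d_def)
    then have "0 \<in> B" using t k by (auto simp: B_def u_def)
    then obtain t0 where t0: "t0 \<in> B" and max: "\<And>x. x \<in> B \<Longrightarrow> x \<le> t0"
      using compact_attains_sup[OF Bc] by auto
    have t0': "0 \<le> t0" "t0 < t" "d t0 \<le> u t0"
      using t0 dt by (auto simp: B_def less_le)
    have above: "u x < d x" if "t0 < x" "x \<le> t" for x
      using max[of x] that t0' by (force simp: B_def)
    \<comment> \<open>The barrier is violated right after \<open>t0\<close>, so continuity from the
      right turns the bound at \<open>t0\<close> into an equality.\<close>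
    have "d t0 \<ge> u t0"
    proof (rule tendsto_le[of "at_right t0" d _ u])
      show "(d \<longlongrightarrow> d t0) (at_right t0)" "(u \<longlongrightarrow> u t0) (at_right t0)"
        using dc uc by (auto simp: continuous_on_def intro: tendsto_within_subset)
      show "\<forall>\<^sub>F x in at_right t0. u x \<le> d x"
        unfolding eventually_at_right_field using t0'(2) above by (intro exI[of _ t]) force
    qed simp
    with t0' have eq: "d t0 = u t0" by simp
    have upos: "u t0 \<ge> k" "u t0 > 0"
    proof -
      have "k * 1 \<le> (k + \<epsilon> * t0) * exp ((L + 1) * t0)"
        using k e t0' L by (intro mult_mono) auto
      then show "u t0 \<ge> k" by (simp add: u_def)
      with k show "u t0 > 0" by simp
    qed
    define W where "W = Tr (X t0)"
    have nW: "norm (X t0 - W) = u t0" using eq by (simp add: W_def d_def)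
    have rW: "rank W = CARD('r)"
      using best_approx_full_rank[OF Tr, of "X t0"] nW upos by (force simp: W_def)
    then obtain S where S: "factorization W (Uf W) S (Vf W)"
      using fac by (auto simp: factor_rule_def)
    let ?R = "X t0 - W" and ?P = "tangent_proj (Uf W) (Vf W) (F W)"
    have split: "inner ?R (F (X t0)) = inner ?R (F (X t0) - F W) + inner ?R (F W - ?P) + inner ?R ?P"
      by (simp add: inner_diff_right)
    have "inner ?R ?P = 0"
      by (rule best_approx_residual_orthogonal[OF _ S]) (simp add: W_def Tr)
    moreover have "inner ?R (F (X t0) - F W) \<le> norm ?R * (L * norm ?R)"
      by (intro order_trans[OF norm_cauchy_schwarz] mult_left_mono Lip) simp
    moreover have "norm (F W - ?P) \<le> \<epsilon>"
      using tan[OF rW S] by (simp add: norm_minus_commute)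
    then have "inner ?R (F W - ?P) \<le> norm ?R * \<epsilon>"
      by (intro order_trans[OF norm_cauchy_schwarz] mult_left_mono) simp_all
    ultimately have dotle: "inner ?R (F (X t0)) \<le> u t0 * (L * u t0 + \<epsilon>)"
      unfolding split nW by (simp add: distrib_left)
    define u' where "u' = \<epsilon> * exp ((L + 1) * t0) + (L + 1) * u t0"
    have du: "(u has_real_derivative u') (at t0)"
      unfolding u_def[abs_def] u'_def by (auto intro!: derivative_eq_intros simp: algebra_simps)
    \<comment> \<open>The 1 in the exponent \<open>L + 1\<close> contributes
      \<open>u t0 > 0\<close>, which makes the inequality strict.\<close>
    have u'gt: "u' > L * u t0 + \<epsilon>"
    proof -
      have "\<epsilon> * 1 \<le> \<epsilon> * exp ((L + 1) * t0)"
        using e t0' L by (intro mult_left_mono) auto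
      then show ?thesis using upos by (simp add: u'_def algebra_simps)
    qed
    \<comment> \<open>The distance to the fixed \<open>W\<close> is at least \<open>d\<close> and
      has a differentiable square. So \<open>g\<close> is 0 at \<open>t0\<close> and positive just
      after, against its negative derivative.\<close>
    define g where "g x = (norm (X x - W))\<^sup>2 - (u x)\<^sup>2" for x
    have "(g has_real_derivative 2 * inner ?R (F (X t0)) - 2 * u t0 * u') (at t0)"
      unfolding g_def[abs_def]
      by (rule derivative_eq_intros has_vector_derivative_norm_sq X du refl)+ simp
    moreover have "2 * inner ?R (F (X t0)) - 2 * u t0 * u' < 0"
      using dotle mult_strict_left_mono[OF u'gt upos(2)] by simp
    ultimately obtain \<delta> where "\<delta> > 0" and dec: "\<And>h. 0 < h \<Longrightarrow> h < \<delta> \<Longrightarrow> g (t0 + h) < g t0"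
      using DERIV_neg_dec_right by blast
    define h where "h = min (\<delta> / 2) (t - t0)"
    have h: "0 < h" "h < \<delta>" "t0 + h \<le> t" using \<open>\<delta> > 0\<close> t0' by (auto simp: h_def)
    have "u (t0 + h) < d (t0 + h)" using above h by simp
    also have "\<dots> \<le> norm (X (t0 + h) - W)"
      using Tr[of "X (t0 + h)"] Tr[of "X t0"] by (simp add: d_def W_def best_approx_def)
    finally have "u (t0 + h) < norm (X (t0 + h) - W)" .
    moreover have "u (t0 + h) \<ge> 0"
      using k e t0' h unfolding u_def by (intro mult_nonneg_nonneg add_nonneg_nonneg) auto
    ultimately have "(u (t0 + h))\<^sup>2 < (norm (X (t0 + h) - W))\<^sup>2"
      by (simp add: power_strict_mono)
    then have "g (t0 + h) > 0" by (simp add: g_def)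
    moreover have "g t0 = 0" by (simp add: g_def nW)
    ultimately show False using dec[OF h(1,2)] by simp
  qed
  have "((\<lambda>k. (k + \<epsilon> * t) * exp ((L + 1) * t)) \<longlongrightarrow> (0 + \<epsilon> * t) * exp ((L + 1) * t)) (at_right 0)"
    by (intro tendsto_intros)
  then have "d t \<le> (0 + \<epsilon> * t) * exp ((L + 1) * t)"
    by (rule tendsto_lowerbound)
      (auto simp: bound eventually_at_right_field intro!: exI[of _ 1])
  then show ?thesis by (simp add: d_def)
qed

text \<open>Nodes may be negative, so the flow is also needed backwards. Time reversal replaces
  \<open>F\<close> by \<open>- F\<close>, which obeys the same Lipschitz and tangent bounds.\<close>

lemma flow_dist_low_rank_abs:
  fixes F :: "real^'n^'m \<Rightarrow> real^'n^'m" and Uf :: "real^'n^'m \<Rightarrow> real^'r^'m"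
  assumes Lip: "\<And>X Y. norm (F X - F Y) \<le> L * norm (X - Y)" and L: "L \<ge> 0" and e: "\<epsilon> \<ge> 0"
    and tan: "\<And>Y (U :: real^'r^'m) S V. rank Y = CARD('r) \<Longrightarrow> factorization Y U S V \<Longrightarrow>
         norm (tangent_proj U V (F Y) - F Y) \<le> \<epsilon>"
    and fac: "factor_rule Uf Vf"
    and Tr: "\<And>X. best_approx CARD('r) X (Tr X)"
    and X: "\<And>t. (X has_vector_derivative F (X t)) (at t)"
    and X0: "rank (X 0) = CARD('r)"
  shows "norm (X t - Tr (X t)) \<le> \<epsilon> * \<bar>t\<bar> * exp ((L + 1) * \<bar>t\<bar>)"
proof (cases "t \<ge> 0")
  case True
  then show ?thesis
    using flow_dist_low_rank[OF Lip L e tan fac Tr X X0] by simp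
next
  case False
  have neg: "tangent_proj U V (- Z) - (- Z) = - (tangent_proj U V Z - Z)" for U :: "real^'r^'m" and V Z
    by (simp add: tangent_proj_def matrix_mult_minus minus_matrix_mult)
  have "norm (X (- (- t)) - Tr (X (- (- t)))) \<le> \<epsilon> * (- t) * exp ((L + 1) * (- t))"
  proof (rule flow_dist_low_rank[where F = "\<lambda>X. - F X" and X = "\<lambda>t. X (- t)"])
    show "norm (- F X - - F Y) \<le> L * norm (X - Y)" for X Y
      using Lip[of Y X] by (simp add: norm_minus_commute)
    show "norm (tangent_proj U V (- F Y) - - F Y) \<le> \<epsilon>"
      if "rank Y = CARD('r)" "factorization Y U S V" for Y and U :: "real^'r^'m" and S V
      unfolding neg norm_minus_cancel by (rule tan[OF that])
    show "((\<lambda>t. X (- t)) has_vector_derivative - F (X (- x))) (at x)" for x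
    proof -
      have "(uminus has_vector_derivative - 1) (at x)"
        by (auto intro!: derivative_eq_intros)
      from vector_diff_chain_at[OF this X] show ?thesis by (simp add: o_def)
    qed
  qed (use fac Tr X0 L e False in auto)
  with False show ?thesis by simp
qed

subsection \<open>Stability of the flow and stage errors\<close>

text \<open>The squared distance grows at rate at most \<open>2 * L\<close>, so its product with
  \<open>exp (- 2 * L * t)\<close> does not increase.\<close>

lemma solution_stability:
  fixes X1 X2 :: "real \<Rightarrow> 'a::real_inner"
  assumes "t0 \<le> t1"
    and Lip: "\<And>X Y. norm (F X - F Y) \<le> L * norm (X - Y)"
    and X1: "\<And>t. t \<in> {t0..t1} \<Longrightarrow> (X1 has_vector_derivative F (X1 t)) (at t within {t0..t1})"
    and X2: "\<And>t. t \<in> {t0..t1} \<Longrightarrow> (X2 has_vector_derivative F (X2 t)) (at t within {t0..t1})"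
  shows "norm (X1 t1 - X2 t1) \<le> exp (L * (t1 - t0)) * norm (X1 t0 - X2 t0)"
proof -
  define D where "D t = X1 t - X2 t" for t
  define g where "g t = (norm (D t))\<^sup>2 * exp (- 2 * L * t)" for t
  let ?g' = "\<lambda>t. (2 * inner (D t) (F (X1 t) - F (X2 t)) - 2 * L * (norm (D t))\<^sup>2) * exp (- 2 * L * t)"
  have g: "(g has_real_derivative ?g' t) (at t within {t0..t1})" if "t \<in> {t0..t1}" for t
  proof -
    have "(D has_vector_derivative F (X1 t) - F (X2 t)) (at t within {t0..t1})"
      unfolding D_def[abs_def] using that by (intro has_vector_derivative_diff X1 X2)
    from has_vector_derivative_norm_sq[OF this, of 0]
    have "((\<lambda>t. (norm (D t))\<^sup>2) has_real_derivative 2 * inner (D t) (F (X1 t) - F (X2 t)))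
        (at t within {t0..t1})" by simp
    moreover have "((\<lambda>t. exp (- 2 * L * t)) has_real_derivative - 2 * L * exp (- 2 * L * t))
        (at t within {t0..t1})"
      by (auto intro!: derivative_eq_intros)
    ultimately have "(g has_real_derivative
        2 * inner (D t) (F (X1 t) - F (X2 t)) * exp (- 2 * L * t)
          + (- 2 * L * exp (- 2 * L * t)) * (norm (D t))\<^sup>2) (at t within {t0..t1})"
      unfolding g_def[abs_def] by (rule DERIV_mult)
    then show ?thesis
      by (rule DERIV_cong) (simp add: left_diff_distrib)
  qed
  have "g t1 \<le> g t0"
  proof (rule DERIV_nonpos_imp_decreasing_open[OF \<open>t0 \<le> t1\<close>])
    fix t assume t: "t0 < t" "t < t1"
    have "(g has_real_derivative ?g' t) (at t)"
      using g[of t] t at_within_Icc_at[of t0 t t1] by simp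
    moreover have "?g' t \<le> 0"
    proof -
      have "inner (D t) (F (X1 t) - F (X2 t)) \<le> norm (D t) * (L * norm (D t))"
        unfolding D_def by (intro order_trans[OF norm_cauchy_schwarz] mult_left_mono Lip) simp
      then show ?thesis by (intro mult_nonpos_nonneg) (auto simp: power2_eq_square mult_ac)
    qed
    ultimately show "\<exists>y. (g has_real_derivative y) (at t) \<and> y \<le> 0" by blast
  next
    show "continuous_on {t0..t1} g"
      using g by (rule DERIV_continuous_on)
  qed
  then have "(norm (D t1))\<^sup>2 * exp (- 2 * L * t1) * exp (2 * L * t1)
      \<le> (norm (D t0))\<^sup>2 * exp (- 2 * L * t0) * exp (2 * L * t1)"
    unfolding g_def by (intro mult_right_mono) auto
  then have "(norm (D t1))\<^sup>2 \<le> (norm (D t0))\<^sup>2 * exp (2 * L * (t1 - t0))"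
    by (simp add: mult.assoc exp_add[symmetric] algebra_simps)
  also have "\<dots> = (exp (L * (t1 - t0)) * norm (D t0))\<^sup>2"
    by (simp add: power_mult_distrib exp_double[symmetric] algebra_simps)
  finally show ?thesis
    unfolding D_def by (rule power2_le_imp_le) simp
qed

text \<open>A bound is asked only where \<open>c j \<noteq> 0\<close>: for \<open>b 2 = 0\<close>
  the less accurate second stage must not enter the step error.\<close>

lemma sum_perturbation_bound:
  fixes v w :: "nat \<Rightarrow> 'a::real_normed_vector"
  assumes "\<And>j. j \<in> J \<Longrightarrow> c j \<noteq> 0 \<Longrightarrow> norm (v j - w j) \<le> K"
    and "(\<Sum>j\<in>J. \<bar>c j\<bar>) \<le> S" "h \<ge> 0" "K \<ge> 0"
  shows "norm ((y + h *\<^sub>R (\<Sum>j\<in>J. c j *\<^sub>R v j)) - (y + h *\<^sub>R (\<Sum>j\<in>J. c j *\<^sub>R w j))) \<le> h * (S * K)"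
proof -
  have "norm (\<Sum>j\<in>J. c j *\<^sub>R (v j - w j)) \<le> (\<Sum>j\<in>J. \<bar>c j\<bar> * K)"
  proof (rule sum_norm_le)
    fix j assume "j \<in> J"
    then show "norm (c j *\<^sub>R (v j - w j)) \<le> \<bar>c j\<bar> * K"
      using assms(1)[of j] by (cases "c j = 0") (auto intro: mult_left_mono)
  qed
  also have "\<dots> \<le> S * K"
    using assms by (simp add: sum_distrib_right[symmetric] mult_right_mono)
  finally have "h * norm (\<Sum>j\<in>J. c j *\<^sub>R (v j - w j)) \<le> h * (S * K)"
    using assms(3) by (rule mult_left_mono)
  moreover have "(y + h *\<^sub>R (\<Sum>j\<in>J. c j *\<^sub>R v j)) - (y + h *\<^sub>R (\<Sum>j\<in>J. c j *\<^sub>R w j))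
      = h *\<^sub>R (\<Sum>j\<in>J. c j *\<^sub>R (v j - w j))"
    by (simp add: scaleR_diff_right sum_subtractf)
  ultimately show ?thesis using assms(3) by simp
qed

text \<open>
  \<open>G\<close> stands for the projected field after truncation, \<open>\<eta>\<close> for its defect, and the premise \<open>trunc\<close>
  says that truncating a stage costs no more than its distance to the exact solution, which has low
  rank up to \<open>O(h \<eta>)\<close>.
\<close>

context
  fixes F G Tr :: "'a::real_normed_vector \<Rightarrow> 'a" and Y :: 'a
    and a :: "nat \<Rightarrow> nat \<Rightarrow> real" and q :: "nat \<Rightarrow> nat" and s :: nat and h \<eta> L \<alpha> c :: real
  assumes Lip: "\<And>X Y. norm (F X - F Y) \<le> L * norm (X - Y)" and L: "L \<ge> 0"
    and h: "0 < h" "h \<le> 1" and eta: "\<eta> \<ge> 0" and c: "c \<ge> 0"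
    and q: "\<And>i j. 1 \<le> i \<Longrightarrow> i \<le> j \<Longrightarrow> j \<le> s \<Longrightarrow> q i \<le> q j"
    and \<alpha>: "\<And>j. j \<in> {1..s} \<Longrightarrow> (\<Sum>l = 1..<j. \<bar>a j l\<bar>) \<le> \<alpha>" "\<alpha> \<ge> 0"
    and defect: "\<And>j. j \<in> {1..s} \<Longrightarrow>
      norm (G (rk_stage a G h Y j) - F (Tr (rk_stage a G h Y j))) \<le> \<eta>"
    and TrY: "Tr Y = Y"
    and trunc: "\<And>j. j \<in> {1..s} \<Longrightarrow> norm (rk_stage a G h Y j - Tr (rk_stage a G h Y j))
      \<le> norm (rk_stage a G h Y j - rk_stage a F h Y j) + c * (h * \<eta> + h ^ (q j + 1))"
begin

text \<open>The error is taken after truncation, where the projected method evaluates the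
  field.\<close>

private abbreviation "err j \<equiv> norm (Tr (rk_stage a G h Y j) - rk_stage a F h Y j)"

text \<open>Inserting \<open>F\<close> at the truncated stage separates the projection defect from
  the propagated stage error.\<close>

lemma field_error:
  assumes "j \<in> {1..s}" "err j \<le> K"
  shows "norm (G (rk_stage a G h Y j) - F (rk_stage a F h Y j)) \<le> \<eta> + L * K"
proof -
  have "norm (F (Tr (rk_stage a G h Y j)) - F (rk_stage a F h Y j)) \<le> L * K"
    using Lip mult_left_mono[OF assms(2) L] by (rule order_trans)
  with defect[OF assms(1)] show ?thesis
    using norm_triangle_ineq[of "G (rk_stage a G h Y j) - F (Tr (rk_stage a G h Y j))"
      "F (Tr (rk_stage a G h Y j)) - F (rk_stage a F h Y j)"] by simp
qed

lemma stage_error_1: "err 1 = 0"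
proof -
  have "rk_stage a f h Y 1 = Y" for f :: "'a \<Rightarrow> 'a"
    by (subst rk_stage.simps) simp
  then show ?thesis by (simp add: TrY)
qed

text \<open>The distance of the untruncated stages enters twice, directly and through
  \<open>trunc\<close>, whence the factor 2.\<close>

lemma stage_error_step:
  assumes j: "j \<in> {1..s}" and K: "\<And>l. l \<in> {1..<j} \<Longrightarrow> err l \<le> K" "K \<ge> 0"
  shows "err j \<le> 2 * (h * (\<alpha> * (\<eta> + L * K))) + c * (h * \<eta> + h ^ (q j + 1))"
proof -
  have "norm (rk_stage a G h Y j - rk_stage a F h Y j) \<le> h * (\<alpha> * (\<eta> + L * K))"
    unfolding rk_stage.simps[of a G h Y j] rk_stage.simps[of a F h Y j]
    using j K h eta L by (intro sum_perturbation_bound \<alpha> field_error) auto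
  with trunc[OF j] show ?thesis
    using norm_triangle_ineq4[of "rk_stage a G h Y j - rk_stage a F h Y j"
      "rk_stage a G h Y j - Tr (rk_stage a G h Y j)"] by simp
qed

text \<open>Each stage multiplies the constant by at most the base of the power. The first stage is
  exact, so the lowest power of \<open>h\<close> comes from the second.\<close>

lemma stage_error_crude:
  assumes "j \<in> {1..s}"
  shows "err j \<le> (1 + 2 * \<alpha> + 2 * \<alpha> * L + c) ^ j * (h * \<eta> + h ^ (q 2 + 1))"
  using assms
proof (induction j rule: less_induct)
  case (less j)
  define M where "M = 1 + 2 * \<alpha> + 2 * \<alpha> * L + c"
  define x where "x = h * \<eta> + h ^ (q 2 + 1)"
  have M: "M \<ge> 1" using \<alpha>(2) L c by (simp add: M_def)
  have x: "x \<ge> 0" "h * \<eta> \<le> x" using h eta by (auto simp: x_def)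
  show ?case
  proof (cases "j = 1")
    case True
    then show ?thesis using stage_error_1 x M by (simp add: M_def x_def)
  next
    case False
    then have j: "2 \<le> j" "j \<le> s" using less.prems by auto
    have mono: "M ^ l \<le> M ^ (j - 1)" if "l < j" for l
      using M that by (intro power_increasing) auto
    have "err l \<le> M ^ (j - 1) * x" if "l \<in> {1..<j}" for l
      using less.IH[of l] that less.prems mult_right_mono[OF mono[of l] x(1)]
      by (auto simp: M_def x_def)
    then have "err j \<le> 2 * (h * (\<alpha> * (\<eta> + L * (M ^ (j - 1) * x)))) + c * (h * \<eta> + h ^ (q j + 1))"
      using less.prems M x by (intro stage_error_step) auto
    also have "\<dots> = 2 * \<alpha> * (h * \<eta>) + h * (2 * \<alpha> * L * (M ^ (j - 1) * x)) + c * (h * \<eta> + h ^ (q j + 1))"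
      by (simp add: algebra_simps)
    \<comment> \<open>\<open>h \<le> 1\<close> removes the factor in front of the recursive
      term.\<close>
    also have "\<dots> \<le> 2 * \<alpha> * x + 1 * (2 * \<alpha> * L * (M ^ (j - 1) * x)) + c * x"
    proof (intro add_mono mult_left_mono mult_right_mono)
      show "h * \<eta> + h ^ (q j + 1) \<le> x"
        using q[of 2 j] j h by (simp add: x_def power_decreasing mult_left_mono)
    qed (use x h \<alpha> L c M in auto)
    also have "\<dots> \<le> M ^ j * x"
    proof -
      have "(2 * \<alpha> + c) * 1 + 2 * \<alpha> * L * M ^ (j - 1) \<le> (2 * \<alpha> + c) * M ^ (j - 1) + 2 * \<alpha> * L * M ^ (j - 1)"
        using M \<alpha>(2) c by (intro add_right_mono mult_left_mono) auto
      also have "\<dots> \<le> M * M ^ (j - 1)"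
        using M by (simp add: M_def distrib_right)
      also have "\<dots> = M ^ j" using j by (simp add: power_eq_if)
      finally have "((2 * \<alpha> + c) * 1 + 2 * \<alpha> * L * M ^ (j - 1)) * x \<le> M ^ j * x"
        using x(1) by (rule mult_right_mono)
      then show ?thesis by (simp add: algebra_simps)
    qed
    finally show ?thesis by (simp add: M_def x_def)
  qed
qed

lemma stage_error_uniform:
  assumes "j \<in> {1..s}"
  shows "err j \<le> (1 + 2 * \<alpha> + 2 * \<alpha> * L + c) ^ s * (h * \<eta> + h ^ (q 2 + 1))"
proof -
  have "1 + 2 * \<alpha> + 2 * \<alpha> * L + c \<ge> 1" using \<alpha>(2) L c by simp
  then have "(1 + 2 * \<alpha> + 2 * \<alpha> * L + c) ^ j \<le> (1 + 2 * \<alpha> + 2 * \<alpha> * L + c) ^ s"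
    using assms by (intro power_increasing) auto
  then have "(1 + 2 * \<alpha> + 2 * \<alpha> * L + c) ^ j * (h * \<eta> + h ^ (q 2 + 1))
      \<le> (1 + 2 * \<alpha> + 2 * \<alpha> * L + c) ^ s * (h * \<eta> + h ^ (q 2 + 1))"
    using h eta by (intro mult_right_mono) auto
  with stage_error_crude[OF assms] show ?thesis by linarith
qed

text \<open>Earlier errors enter multiplied by \<open>h\<close>, which raises \<open>q 2 + 1\<close>
  to \<open>q 2 + 2\<close>; the stage's own truncation costs at most order \<open>q 3 + 1\<close>
  by monotonicity of \<open>q\<close>.\<close>

lemma stage_error_refined:
  assumes "3 \<le> j" "j \<le> s"
  shows "err j \<le> (2 * \<alpha> * (1 + L * (1 + 2 * \<alpha> + 2 * \<alpha> * L + c) ^ s) + c)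
    * (h * \<eta> + h ^ (q 2 + 2) + h ^ (q 3 + 1))"
proof -
  define K where "K = (1 + 2 * \<alpha> + 2 * \<alpha> * L + c) ^ s"
  define x where "x = h * \<eta> + h ^ (q 2 + 1)"
  define y where "y = h * \<eta> + h ^ (q 2 + 2) + h ^ (q 3 + 1)"
  have K: "K \<ge> 0" using \<alpha>(2) L c by (simp add: K_def)
  have x: "x \<ge> 0" using h eta by (simp add: x_def)
  have "err j \<le> 2 * (h * (\<alpha> * (\<eta> + L * (K * x)))) + c * (h * \<eta> + h ^ (q j + 1))"
    using assms stage_error_uniform K x by (intro stage_error_step) (auto simp: K_def x_def)
  also have "\<dots> = 2 * \<alpha> * (h * \<eta> + L * K * (h * x)) + c * (h * \<eta> + h ^ (q j + 1))"
    by (simp add: algebra_simps)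
  also have "\<dots> \<le> 2 * \<alpha> * (y + L * K * y) + c * y"
  proof (intro add_mono mult_left_mono)
    show "h * \<eta> \<le> y" using h by (simp add: y_def)
    have "h * (h * \<eta>) \<le> h * \<eta>" using h eta by (simp add: mult_left_le_one_le)
    then show "h * x \<le> y" using h by (simp add: x_def y_def distrib_left add_increasing2)
    have "h ^ (q j + 1) \<le> h ^ (q 3 + 1)" using q[of 3 j] assms h by (intro power_decreasing) auto
    then show "h * \<eta> + h ^ (q j + 1) \<le> y" using h by (simp add: y_def add_increasing)
  qed (use K L \<alpha>(2) c in auto)
  finally show ?thesis by (simp add: K_def y_def algebra_simps)
qed

text \<open>For \<open>b 2 \<noteq> 0\<close> the uniform stage bound is used. For
  \<open>b 2 = 0\<close> the stages with nonzero weight are the exact first one and those from the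
  third on, where the refined bound holds.\<close>

lemma step_error:
  fixes b :: "nat \<Rightarrow> real" and p :: nat
  defines "K \<equiv> (1 + 2 * \<alpha> + 2 * \<alpha> * L + c) ^ s"
  defines "Q \<equiv> (if b 2 \<noteq> 0 then min p (q 2 + 1) else min p (min (q 3 + 1) (q 2 + 2)))"
  assumes "(\<Sum>j = 1..s. \<bar>b j\<bar>) \<le> \<beta>"
  shows "norm (rk_step s a b G h Y - rk_step s a b F h Y)
    \<le> h * (\<beta> * ((1 + L * (K + 2 * (2 * \<alpha> * (1 + L * K) + c))) * (\<eta> + h ^ Q)))"
proof -
  define K' where "K' = 2 * \<alpha> * (1 + L * K) + c"
  define z where "z = \<eta> + h ^ Q"
  have K: "K \<ge> 0" using \<alpha>(2) L c by (simp add: K_def)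
  have K': "K' \<ge> 0" using \<alpha>(2) L c K by (simp add: K'_def)
  have z: "z \<ge> 0" "\<eta> \<le> z" using h eta by (auto simp: z_def)
  have heta: "h * \<eta> \<le> \<eta>" using h eta by (simp add: mult_left_le_one_le)
  have E: "err j \<le> (K + 2 * K') * z" if j: "j \<in> {1..s}" and bj: "b j \<noteq> 0" for j
  proof (cases "b 2 = 0")
    case False
    then have "h ^ (q 2 + 1) \<le> h ^ Q" using h by (intro power_decreasing) (auto simp: Q_def)
    then have "K * (h * \<eta> + h ^ (q 2 + 1)) \<le> K * z"
      using heta K by (intro mult_left_mono) (auto simp: z_def)
    also have "\<dots> \<le> (K + 2 * K') * z"
      using z K' by (intro mult_right_mono) auto
    finally show ?thesis using stage_error_uniform[OF j] by (simp add: K_def)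
  next
    case True
    show ?thesis
    proof (cases "j = 1")
      case True
      then show ?thesis using stage_error_1 K K' z by simp
    next
      case j1: False
      have "j \<noteq> 2" using True bj by auto
      then have j3: "3 \<le> j" "j \<le> s" using j j1 by auto
      have "h ^ (q 2 + 2) \<le> h ^ Q" "h ^ (q 3 + 1) \<le> h ^ Q"
        using True h by (intro power_decreasing; auto simp: Q_def)+
      \<comment> \<open>Two powers of \<open>h\<close> are each bounded by \<open>h ^ Q\<close>,
        hence \<open>2 * z\<close>.\<close>
      then have "K' * (h * \<eta> + h ^ (q 2 + 2) + h ^ (q 3 + 1)) \<le> K' * (2 * z)"
        using heta K' eta by (intro mult_left_mono) (auto simp: z_def)
      also have "\<dots> \<le> (K + 2 * K') * z"
        using z K by (simp add: algebra_simps)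
      finally show ?thesis using stage_error_refined[OF j3] by (simp add: K_def K'_def)
    qed
  qed
  have "norm (rk_step s a b G h Y - rk_step s a b F h Y)
      \<le> h * (\<beta> * ((1 + L * (K + 2 * K')) * z))"
    unfolding rk_step_def
  proof (rule sum_perturbation_bound)
    fix j assume j: "j \<in> {1..s}" "b j \<noteq> 0"
    have "norm (G (rk_stage a G h Y j) - F (rk_stage a F h Y j)) \<le> \<eta> + L * ((K + 2 * K') * z)"
      using j by (intro field_error E)
    also have "\<dots> \<le> (1 + L * (K + 2 * K')) * z"
      using z by (simp add: algebra_simps)
    finally show "norm (G (rk_stage a G h Y j) - F (rk_stage a F h Y j)) \<le> (1 + L * (K + 2 * K')) * z" .
  qed (use assms(3) h L K K' z in auto)
  then show ?thesis by (simp add: K'_def z_def)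
qed

end

text \<open>Each new defect is enlarged by an exponential factor at least 1, so that the defects
  accumulate as a plain sum behind a common factor.\<close>

lemma gronwall_discrete:
  fixes e :: "nat \<Rightarrow> real"
  assumes step: "\<And>i. i < N \<Longrightarrow> e (Suc i) \<le> exp (L * h) * e i + h * w"
    and "L \<ge> 0" "h \<ge> 0" "w \<ge> 0" "i \<le> N"
  shows "e i \<le> exp (L * (real i * h)) * (e 0 + real i * h * w)"
  using \<open>i \<le> N\<close>
proof (induction i)
  case (Suc i)
  have "e (Suc i) \<le> exp (L * h) * e i + h * w"
    using Suc.prems by (intro step) simp
  also have "\<dots> \<le> exp (L * h) * (exp (L * (real i * h)) * (e 0 + real i * h * w))
      + exp (L * (real (Suc i) * h)) * (h * w)"
    using Suc assms(2-4) mult_right_mono[of 1 "exp (L * (real (Suc i) * h))" "h * w"]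
    by (intro add_mono mult_left_mono) auto
  also have "\<dots> = exp (L * (real (Suc i) * h)) * (e 0 + real (Suc i) * h * w)"
    by (simp add: algebra_simps exp_add)
  finally show ?case .
qed simp

subsection \<open>Local and global error\<close>

text \<open>
  The flow is needed at times of size at most \<open>\<nu> h\<close>, where it has rank at most $r$ up to \<open>B h \<eta>\<close>; \<open>K\<close>
  bounds the stage errors in units of $h \eta + h^{q_2 + 1}$.
\<close>

definition prk_local_const ::
  "nat \<Rightarrow> (nat \<Rightarrow> nat \<Rightarrow> real) \<Rightarrow> (nat \<Rightarrow> real) \<Rightarrow> real \<Rightarrow> real \<Rightarrow> real" where
  "prk_local_const s a b L C =
     (let \<alpha> = \<Sum>j = 1..s. \<Sum>l = 1..<j. \<bar>a j l\<bar>; \<beta> = \<Sum>j = 1..s. \<bar>b j\<bar>;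
          \<nu> = 1 + (\<Sum>j = 1..s. \<bar>rk_node a j\<bar>); B = \<nu> * exp ((L + 1) * \<nu>);
          K = (1 + 2 * \<alpha> + 2 * \<alpha> * L + (C + B)) ^ s
      in 2 * (\<beta> * (1 + L * (K + 2 * (2 * \<alpha> * (1 + L * K) + (C + B))))) + 2 * C + B)"

lemma prk_local_const_nonneg:
  assumes "L \<ge> 0" "C \<ge> 0"
  shows "prk_local_const s a b L C \<ge> 0"
proof -
  define \<alpha> where "\<alpha> = (\<Sum>j = 1..s. \<Sum>l = 1..<j. \<bar>a j l\<bar>)"
  define \<beta> where "\<beta> = (\<Sum>j = 1..s. \<bar>b j\<bar>)"
  define \<nu> where "\<nu> = 1 + (\<Sum>j = 1..s. \<bar>rk_node a j\<bar>)"
  have "\<alpha> \<ge> 0" "\<beta> \<ge> 0" "\<nu> \<ge> 0"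
    by (simp_all add: \<alpha>_def \<beta>_def \<nu>_def sum_nonneg add_nonneg_nonneg)
  then show ?thesis
    unfolding prk_local_const_def Let_def \<alpha>_def[symmetric] \<beta>_def[symmetric] \<nu>_def[symmetric]
    using assms by simp
qed

text \<open>The error splits into the perturbation of the untruncated step, the order
  \<open>p\<close> error of the Runge-Kutta step and the final truncation. The choice of
  \<open>P\<close> enters through its defect \<open>\<eta>\<close>.\<close>

lemma prk_local_error:
  fixes F :: "real^'n^'m \<Rightarrow> real^'n^'m" and Uf :: "real^'n^'m \<Rightarrow> real^'r^'m"
  assumes Lip: "\<And>X Y. norm (F X - F Y) \<le> L * norm (X - Y)" and L: "L \<ge> 0"
    and e: "0 \<le> \<epsilon>" "\<epsilon> \<le> \<eta>" and C: "C \<ge> 0"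
    and tan: "\<And>Y (U :: real^'r^'m) S V. rank Y = CARD('r) \<Longrightarrow> factorization Y U S V \<Longrightarrow>
         norm (tangent_proj U V (F Y) - F Y) \<le> \<epsilon>"
    and fac: "factor_rule Uf Vf"
    and Tr: "\<And>X. best_approx CARD('r) X (Tr X)"
    and flow: "is_flow F \<phi>" and order: "order_bounds CARD('r) s a b p q C hs F \<phi>"
    and q: "\<And>i j. 1 \<le> i \<Longrightarrow> i \<le> j \<Longrightarrow> j \<le> s \<Longrightarrow> q i \<le> q j"
    and defect: "\<And>Y. rank Y = CARD('r) \<Longrightarrow> norm (P Y (F Y) - F Y) \<le> \<eta>"
    and h: "0 < h" "h \<le> 1" "h \<le> hs"
    and Y: "rank Y = CARD('r)"
    and stages: "\<And>j. j \<in> {1..s} \<Longrightarrow> rank (Tr (prk_stage a Tr P F h Y j)) = CARD('r)"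
  shows "norm (prk_step s a b Tr P F h Y - \<phi> h Y) \<le> h * (prk_local_const s a b L C *
    (\<eta> + h ^ (if b 2 \<noteq> 0 then min p (q 2 + 1) else min p (min (q 3 + 1) (q 2 + 2)))))"
proof -
  define \<alpha> where "\<alpha> = (\<Sum>j = 1..s. \<Sum>l = 1..<j. \<bar>a j l\<bar>)"
  define \<beta> where "\<beta> = (\<Sum>j = 1..s. \<bar>b j\<bar>)"
  \<comment> \<open>The sum covers the node times \<open>rk_node a j * h\<close>, the summand 1 the
    full step \<open>h\<close>.\<close>
  define \<nu> where "\<nu> = 1 + (\<Sum>j = 1..s. \<bar>rk_node a j\<bar>)"
  define B where "B = \<nu> * exp ((L + 1) * \<nu>)"
  define K where "K = (1 + 2 * \<alpha> + 2 * \<alpha> * L + (C + B)) ^ s"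
  define \<Gamma> where "\<Gamma> = 1 + L * (K + 2 * (2 * \<alpha> * (1 + L * K) + (C + B)))"
  define Q where "Q = (if b 2 \<noteq> 0 then min p (q 2 + 1) else min p (min (q 3 + 1) (q 2 + 2)))"
  define G where "G = (\<lambda>Z. P (Tr Z) (F (Tr Z)))"
  have \<nu>: "\<nu> \<ge> 1" by (simp add: \<nu>_def sum_nonneg)
  have B: "B \<ge> 0" using \<nu> by (simp add: B_def)
  have eta: "\<eta> \<ge> 0" using e by simp
  have const: "prk_local_const s a b L C = 2 * (\<beta> * \<Gamma>) + 2 * C + B"
    by (simp add: prk_local_const_def Let_def \<alpha>_def \<beta>_def \<nu>_def B_def K_def \<Gamma>_def)
  have dist_flow: "norm (\<phi> t Y - Tr (\<phi> t Y)) \<le> B * (h * \<eta>)" if t: "\<bar>t\<bar> \<le> \<nu> * h" for t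
  proof -
    have "\<bar>t\<bar> \<le> \<nu>"
      using t mult_left_mono[OF h(2), of \<nu>] \<nu> by linarith
    have "norm (\<phi> t Y - Tr (\<phi> t Y)) \<le> \<epsilon> * \<bar>t\<bar> * exp ((L + 1) * \<bar>t\<bar>)"
    proof (rule flow_dist_low_rank_abs[where X = "\<lambda>t. \<phi> t Y"])
      show "((\<lambda>t. \<phi> t Y) has_vector_derivative F (\<phi> x Y)) (at x)" for x
        using flow by (simp add: is_flow_def)
      show "rank (\<phi> 0 Y) = CARD('r)" using flow Y by (simp add: is_flow_def)
    qed (use Lip L e tan fac Tr in auto)
    also have "\<dots> \<le> \<eta> * (\<nu> * h) * exp ((L + 1) * \<nu>)"
      using e t L \<nu> h \<open>\<bar>t\<bar> \<le> \<nu>\<close> by (intro mult_mono) auto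
    finally show ?thesis by (simp add: B_def mult_ac)
  qed
  have trunc: "norm (Z - Tr Z) \<le> norm (Z - \<phi> t Y) + B * (h * \<eta>)" if "\<bar>t\<bar> \<le> \<nu> * h" for Z t
    using best_approx_dist_Lipschitz[OF Tr Tr, of Z "\<phi> t Y"] dist_flow[OF that] by simp
  have TrY: "Tr Y = Y" using best_approx_fixes[OF Tr] Y by simp
  have defect': "norm (G (rk_stage a G h Y j) - F (Tr (rk_stage a G h Y j))) \<le> \<eta>"
    if "j \<in> {1..s}" for j
    using defect[OF stages[OF that]] by (simp add: G_def prk_stage_def)
  have trunc_stage: "norm (rk_stage a G h Y j - Tr (rk_stage a G h Y j))
      \<le> norm (rk_stage a G h Y j - rk_stage a F h Y j) + (C + B) * (h * \<eta> + h ^ (q j + 1))"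
    if j: "j \<in> {1..s}" for j
  proof -
    have "\<bar>rk_node a j\<bar> \<le> \<nu>"
      using j member_le_sum[of j "{1..s}" "\<lambda>j. \<bar>rk_node a j\<bar>"] by (simp add: \<nu>_def)
    then have "\<bar>rk_node a j * h\<bar> \<le> \<nu> * h" using h by (simp add: abs_mult)
    note trunc[OF this, of "rk_stage a G h Y j"]
    moreover have "norm (rk_stage a F h Y j - \<phi> (rk_node a j * h) Y) \<le> C * h ^ (q j + 1)"
      using order Y h j by (simp add: order_bounds_def)
    moreover have "C * h ^ (q j + 1) + B * (h * \<eta>) \<le> (C + B) * (h * \<eta> + h ^ (q j + 1))"
      using C B h eta by (simp add: algebra_simps)
    ultimately show ?thesis
      using norm_triangle_ineq[of "rk_stage a G h Y j - rk_stage a F h Y j"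
        "rk_stage a F h Y j - \<phi> (rk_node a j * h) Y"] by simp
  qed
  define Z where "Z = rk_step s a b G h Y"
  have "norm (Z - rk_step s a b F h Y) \<le> h * (\<beta> * (\<Gamma> * (\<eta> + h ^ Q)))"
    unfolding Z_def \<Gamma>_def K_def Q_def
  proof (rule step_error[OF Lip L h(1,2) eta _ q _ _ defect' TrY trunc_stage])
    show "(\<Sum>l = 1..<j. \<bar>a j l\<bar>) \<le> \<alpha>" if "j \<in> {1..s}" for j
      unfolding \<alpha>_def using that
      by (intro member_le_sum[of j "{1..s}" "\<lambda>j. \<Sum>l = 1..<j. \<bar>a j l\<bar>"]) (auto simp: sum_nonneg)
  qed (use C B in \<open>auto simp: \<beta>_def \<alpha>_def sum_nonneg\<close>)
  moreover have "norm (rk_step s a b F h Y - \<phi> h Y) \<le> C * h ^ (p + 1)"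
    using order Y h by (simp add: order_bounds_def)
  moreover have "C * h ^ (p + 1) \<le> h * (C * (\<eta> + h ^ Q))"
  proof -
    have "h ^ p \<le> \<eta> + h ^ Q"
    proof -
      have "Q \<le> p" by (simp add: Q_def)
      then have "h ^ p \<le> h ^ Q" using h by (intro power_decreasing) auto
      then show ?thesis using eta by simp
    qed
    then have "h * (C * h ^ p) \<le> h * (C * (\<eta> + h ^ Q))"
      using C h by (intro mult_left_mono) auto
    then show ?thesis by (simp add: mult_ac)
  qed
  ultimately have "norm (Z - \<phi> h Y) \<le> h * (\<beta> * (\<Gamma> * (\<eta> + h ^ Q))) + h * (C * (\<eta> + h ^ Q))"
    using norm_triangle_ineq[of "Z - rk_step s a b F h Y" "rk_step s a b F h Y - \<phi> h Y"] by simp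
  \<comment> \<open>Truncation at most doubles the error, up to the distance of the flow from low
    rank.\<close>
  moreover have "norm (Tr Z - \<phi> h Y) \<le> 2 * norm (Z - \<phi> h Y) + B * (h * \<eta>)"
    using trunc[of h Z] \<nu> h norm_triangle_ineq4[of "Z - \<phi> h Y" "Z - Tr Z"] by simp
  moreover have "B * (h * \<eta>) \<le> h * (B * (\<eta> + h ^ Q))"
    using B h by (simp add: algebra_simps)
  ultimately have "norm (Tr Z - \<phi> h Y) \<le> h * ((2 * (\<beta> * \<Gamma>) + 2 * C + B) * (\<eta> + h ^ Q))"
    by (simp add: algebra_simps)
  then show ?thesis
    by (simp add: const Q_def Z_def prk_step_def G_def)
qed

text \<open>\<open>h0\<close>, \<open>c12\<close> and \<open>c34\<close> are chosen before the
  field, \<open>\<epsilon>\<close>, the initial data and the DEIM rules, hence independently of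
  them. The rank premise on iterates and stages says that all truncations that occur lie on the
  manifold.\<close>

theorem theorem14:
  fixes L l T C\<^sub>L hs :: real
    and s p :: nat
    and a :: "nat \<Rightarrow> nat \<Rightarrow> real" and b :: "nat \<Rightarrow> real" and q :: "nat \<Rightarrow> nat"
  assumes "L \<ge> 0" and "T \<ge> 0" and "C\<^sub>L > 0" and "hs > 0"
    and "s \<ge> 2" and "b 2 = 0 \<Longrightarrow> s \<ge> 3"
    and "\<And>i j. 1 \<le> i \<Longrightarrow> i \<le> j \<Longrightarrow> j \<le> s \<Longrightarrow> q i \<le> q j"
  shows "\<exists>h0>0. \<exists>c12 c34 :: real.
    \<forall>(F :: real^'n^'m \<Rightarrow> real^'n^'m) \<phi> A \<epsilon> Y0 Cm Cn
      (SU :: real^'r^'m \<Rightarrow> real^'r^'m) (SV :: real^'r^'n \<Rightarrow> real^'r^'n) Uf Vf Tr h N.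
      (\<forall>X Y. norm (F X - F Y) \<le> L * norm (X - Y)) \<longrightarrow>
      (\<forall>X Y. inner (X - Y) (F X - F Y) \<le> l * (norm (X - Y))\<^sup>2) \<longrightarrow>
      \<epsilon> \<ge> 0 \<longrightarrow>
      (\<forall>Y (U :: real^'r^'m) S V. rank Y = CARD('r) \<and> factorization Y U S V \<longrightarrow>
         norm (tangent_proj U V (F Y) - F Y) \<le> \<epsilon>) \<longrightarrow>
      is_flow F \<phi> \<longrightarrow>
      order_bounds CARD('r) s a b p q C\<^sub>L hs F \<phi> \<longrightarrow>
      (\<forall>t\<in>{0..T}. (A has_vector_derivative F (A t)) (at t within {0..T})) \<longrightarrow>
      deim_rule Cm SU \<longrightarrow> deim_rule Cn SV \<longrightarrow> factor_rule Uf Vf \<longrightarrow>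
      (\<forall>X. best_approx CARD('r) X (Tr X)) \<longrightarrow>
      rank Y0 = CARD('r) \<longrightarrow>
      0 < h \<longrightarrow> h < h0 \<longrightarrow> real N * h \<le> T \<longrightarrow>
      (let P = deim_proj Uf Vf SU SV; Y = prk_iterate s a b Tr P F h Y0
       in (\<forall>i<N. rank (Y (Suc i)) = CARD('r) \<and>
             (\<forall>j\<in>{1..s}. rank (Tr (prk_stage a Tr P F h (Y i) j)) = CARD('r))) \<longrightarrow>
          norm (A (real N * h) - Y N) \<le>
            c12 * (norm (A 0 - Y0) + c34 * Cm * Cn * \<epsilon> +
              h ^ (if b 2 \<noteq> 0 then min p (q 2 + 1) else min p (min (q 3 + 1) (q 2 + 2)))))"
proof -
  define M where "M = prk_local_const s a b L C\<^sub>L"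
  define Q where "Q = (if b 2 \<noteq> 0 then min p (q 2 + 1) else min p (min (q 3 + 1) (q 2 + 2)))"
  have M: "M \<ge> 0" unfolding M_def using assms by (intro prk_local_const_nonneg) auto
  have "norm (A (real N * h) - prk_iterate s a b Tr (deim_proj Uf Vf SU SV) F h Y0 N) \<le>
      exp (L * T) * (1 + T * M) * (norm (A 0 - Y0) + 4 * Cm * Cn * \<epsilon> + h ^ Q)"
    if Lip: "\<forall>X Y. norm (F X - F Y) \<le> L * norm (X - Y)"
      and e: "\<epsilon> \<ge> 0"
      and tan: "\<forall>Y (U :: real^'r^'m) S V. rank Y = CARD('r) \<and> factorization Y U S V \<longrightarrow>
         norm (tangent_proj U V (F Y) - F Y) \<le> \<epsilon>"
      and flow: "is_flow F \<phi>"
      and order: "order_bounds CARD('r) s a b p q C\<^sub>L hs F \<phi>"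
      and A: "\<forall>t\<in>{0..T}. (A has_vector_derivative F (A t)) (at t within {0..T})"
      and deim: "deim_rule Cm SU" "deim_rule Cn SV" and fac: "factor_rule Uf Vf"
      and Tr: "\<forall>X. best_approx CARD('r) X (Tr X)"
      and Y0: "rank Y0 = CARD('r)"
      and h: "0 < h" "h < min 1 hs" and NT: "real N * h \<le> T"
      and ranks: "\<forall>i<N. rank (prk_iterate s a b Tr (deim_proj Uf Vf SU SV) F h Y0 (Suc i)) = CARD('r) \<and>
        (\<forall>j\<in>{1..s}. rank (Tr (prk_stage a Tr (deim_proj Uf Vf SU SV) F h
          (prk_iterate s a b Tr (deim_proj Uf Vf SU SV) F h Y0 i) j)) = CARD('r))"
    for F :: "real^'n^'m \<Rightarrow> real^'n^'m" and \<phi> A \<epsilon> Y0 Cm Cn h N Tr Uf Vf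
      and SU :: "real^'r^'m \<Rightarrow> real^'r^'m" and SV :: "real^'r^'n \<Rightarrow> real^'r^'n"
  proof -
    define P where "P = deim_proj Uf Vf SU SV"
    define Y where "Y = prk_iterate s a b Tr P F h Y0"
    define \<eta> where "\<eta> = 4 * Cm * Cn * \<epsilon>"
    define w where "w = \<eta> + h ^ Q"
    have Y_0: "Y 0 = Y0" by (simp add: Y_def prk_iterate_def)
    have Y_Suc: "Y (Suc i) = prk_step s a b Tr P F h (Y i)" for i
      by (simp add: Y_def prk_iterate_def)
    have rank_Y: "rank (Y i) = CARD('r)" if "i \<le> N" for i
      using ranks Y0 Y_0 that by (cases i) (auto simp: Y_def P_def)
    \<comment> \<open>The factors of \<open>Y0\<close> supply the orthonormal matrices from which
      \<open>Cm\<close> and \<open>Cn\<close> are seen to be at least 1.\<close>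
    obtain S where S: "factorization Y0 (Uf Y0) S (Vf Y0)"
      using fac Y0 by (auto simp: factor_rule_def)
    then have Cm: "Cm \<ge> 1" and Cn: "Cn \<ge> 1"
      using deim_const_ge_1 deim by (auto simp: factorization_def)
    have "1 * 1 \<le> Cm * Cn" using Cm Cn by (intro mult_mono) auto
    then have "1 * \<epsilon> \<le> (4 * (Cm * Cn)) * \<epsilon>" using e by (intro mult_right_mono) auto
    then have \<eta>: "\<epsilon> \<le> \<eta>" by (simp add: \<eta>_def mult.assoc)
    have w: "w \<ge> 0" using \<eta> e h by (simp add: w_def)
    have defect: "norm (P Z (F Z) - F Z) \<le> \<eta>" if Z: "rank Z = CARD('r)" for Z
    proof -
      obtain S where S: "factorization Z (Uf Z) S (Vf Z)"
        using fac Z by (auto simp: factor_rule_def)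
      have "norm (P Z (F Z) - F Z) \<le> 4 * Cm * Cn * norm (tangent_proj (Uf Z) (Vf Z) (F Z) - F Z)"
        unfolding P_def using S by (intro deim_proj_error deim) (auto simp: factorization_def)
      also have "\<dots> \<le> \<eta>"
        unfolding \<eta>_def using tan S Z Cm Cn by (intro mult_left_mono) auto
      finally show ?thesis .
    qed
    define err where "err i = norm (A (real i * h) - Y i)" for i
    have step: "err (Suc i) \<le> exp (L * h) * err i + h * (M * w)" if i: "i < N" for i
    proof -
      define t where "t = real i * h"
      have "real (Suc i) * h \<le> real N * h" using i h by (intro mult_right_mono) auto
      then have t: "0 \<le> t" "t + h \<le> T" using NT h by (auto simp: t_def algebra_simps)
      \<comment> \<open>The flow restarted from \<open>Y i\<close> at time \<open>t\<close> is
        compared with \<open>A\<close> over one step: stability carries the old error along, and the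
        local error is added.\<close>
      have "norm (A (t + h) - \<phi> (t + h - t) (Y i)) \<le> exp (L * (t + h - t)) * norm (A t - \<phi> (t - t) (Y i))"
      proof (rule solution_stability[where F = F])
        show "norm (F X - F Y) \<le> L * norm (X - Y)" for X Y using Lip by blast
        fix x assume x: "x \<in> {t..t + h}"
        show "(A has_vector_derivative F (A x)) (at x within {t..t + h})"
          by (rule has_vector_derivative_within_subset[where S = "{0..T}"]) (use A x t in auto)
        have "((\<lambda>y. y - t) has_vector_derivative 1) (at x)"
          by (auto intro!: derivative_eq_intros)
        moreover have "((\<lambda>\<tau>. \<phi> \<tau> (Y i)) has_vector_derivative F (\<phi> (x - t) (Y i))) (at (x - t))"
          using flow by (simp add: is_flow_def)
        ultimately have "((\<lambda>\<tau>. \<phi> \<tau> (Y i)) \<circ> (\<lambda>y. y - t) has_vector_derivative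
            1 *\<^sub>R F (\<phi> (x - t) (Y i))) (at x)"
          by (rule vector_diff_chain_at)
        then show "((\<lambda>y. \<phi> (y - t) (Y i)) has_vector_derivative F (\<phi> (x - t) (Y i))) (at x within {t..t + h})"
          by (simp add: o_def has_vector_derivative_at_within)
      qed (use h in auto)
      then have "norm (A (t + h) - \<phi> h (Y i)) \<le> exp (L * h) * err i"
        using flow by (simp add: is_flow_def err_def t_def)
      moreover have "norm (Y (Suc i) - \<phi> h (Y i)) \<le> h * (M * w)"
        unfolding Y_Suc M_def w_def Q_def
      proof (rule prk_local_error[where F = F and Uf = Uf and Vf = Vf and \<epsilon> = \<epsilon> and hs = hs])
        show "rank (Tr (prk_stage a Tr P F h (Y i) j)) = CARD('r)" if "j \<in> {1..s}" for j
          using ranks i that by (simp add: Y_def P_def)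
      qed (use Lip assms e \<eta> tan fac Tr flow order defect h rank_Y i in auto)
      moreover have "real (Suc i) * h = t + h" by (simp add: t_def algebra_simps)
      ultimately show ?thesis
        using norm_triangle_ineq4[of "A (t + h) - \<phi> h (Y i)" "Y (Suc i) - \<phi> h (Y i)"]
        by (simp add: err_def)
    qed
    have "err N \<le> exp (L * (real N * h)) * (err 0 + real N * h * (M * w))"
      using step assms(1) h M w by (intro gronwall_discrete[of N err L h]) auto
    also have "\<dots> \<le> exp (L * T) * (err 0 + T * (M * w))"
      using NT assms M w h by (intro mult_mono add_left_mono mult_right_mono) (auto simp: err_def mult_left_mono)
    also have "\<dots> \<le> exp (L * T) * ((1 + T * M) * (err 0 + w))"
    proof -
      have "0 \<le> T * M * err 0" using assms(2) M by (simp add: err_def)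
      then show ?thesis using w by (intro mult_left_mono) (auto simp: algebra_simps)
    qed
    finally show ?thesis
      by (simp add: err_def Y_0 w_def \<eta>_def mult.assoc add.assoc) (simp add: Y_def P_def)
  qed
  \<comment> \<open>\<open>min 1 hs\<close> ensures \<open>h \<le> 1\<close> and the range of the
    order bounds; 4 is the factor of the DEIM defect.\<close>
  then show ?thesis
    unfolding Let_def Q_def[symmetric]
    using assms(4) by (intro exI[of _ "min 1 hs"] conjI exI[of _ "exp (L * T) * (1 + T * M)"] exI[of _ 4]) auto
qed

end
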